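(* Let $K_n=(V,E)$ be the complete graph on $n\ge 2$ nodes and let $P_{\mathrm{match}}(n)=\operatorname{conv}\{\chi(M): M \text{ a matching in } K_n\}\subseteq\mathbb{R}^E$ be the Matching polytope, whose circuits are taken with respect to the linear description $$\bm{x}(E[S])\le (|S|-1)/2 \ \ \text{for all } S\subseteq V,\ |S| \text{ odd},\ |S|\ge 3;\qquad \bm{x}(\delta(v))\le 1\ \ \text{for all } v\in V;\qquad \bm{x}\ge \bm{0}.$$ Then the circuit diameter of $P_{\mathrm{match}}(n)$ is $$\mathcal{CD}(P_{\mathrm{match}}(n))=\begin{cases}1 & n=2,3,\\ 2 & n=4,5,\\ 3 & n=6,\\ 2 & n\ge 7.\end{cases}$$
   Context: For a matching (edge set) $M$, $\chi(M)\in\{0,1\}^E$ is its characteristic vector. $E[S]$ is the set of edges with both endpoints in $S$, $\delta(v)$ the set of edges incident to $v$, and $\bm{x}(F)=\sum_{e\in F}x_e$. Circuits: for a polytope $P=\{\bm{x}: A\bm{x}=\bm{b},\ B\bm{x}\le \bm{d}\}$ given by a fixed linear system, a nonzero vector $\bm{g}$ is a circuit of $P$ if $A\bm{g}=\bm{0}$ and $\operatorname{supp}(B\bm{g})$ is inclusion-minimal among the sets $\operatorname{supp}(B\bm{y})$ with $A\bm{y}=\bm{0}$, $\bm{y}\neq\bm{0}$. A point $\bm{x}''\in P$ is one circuit step from $\bm{x}'\in P$ if $\bm{x}''=\bm{x}'+\alpha\bm{c}$ for a circuit $\bm{c}$ and $\alpha>0$ maximal such that $\bm{x}'+\alpha\bm{c}\in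 P$. A circuit walk from $\bm{x}'$ to $\bm{x}''$ of length $l$ is a sequence $\bm{x}'=\bm{z}^0,\dots,\bm{z}^l=\bm{x}''$ of points of $P$ with each $\bm{z}^i$ one circuit step from $\bm{z}^{i-1}$. The circuit distance $\mathrm{cdist}(\bm{x}',\bm{x}'')$ is the length of a shortest circuit walk from $\bm{x}'$ to $\bm{x}''$ (not necessarily symmetric), and the circuit diameter $\mathcal{CD}(P)$ is the maximum circuit distance over all ordered pairs of vertices of $P$. *)

theory Defs
  imports "HOL-Analysis.Analysis" "HOL-Library.Extended_Nat"
begin

definition V :: "nat \<Rightarrow> nat set" where
  "V n = {0..<n}"

definition E :: "nat \<Rightarrow> nat set set" where
  "E n = {{i, j} | i j. i < n \<and> j < n \<and> i \<noteq> j}"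

definition RE :: "nat \<Rightarrow> (nat set \<Rightarrow> real) set" where
  "RE n = {x. \<forall>e. e \<notin> E n \<longrightarrow> x e = 0}"

definition matching :: "nat \<Rightarrow> nat set set \<Rightarrow> bool" where
  "matching n M \<longleftrightarrow> M \<subseteq> E n \<and> (\<forall>e\<in>M. \<forall>f\<in>M. e \<noteq> f \<longrightarrow> e \<inter> f = {})"

definition chi :: "nat set set \<Rightarrow> nat set \<Rightarrow> real" where
  "chi M = (\<lambda>e. if e \<in> M then 1 else 0)"

definition Pmatch :: "nat \<Rightarrow> (nat set \<Rightarrow> real) set" where
  "Pmatch n = {x. \<exists>\<mu> :: nat set set \<Rightarrow> real.
      (\<forall>M. 0 \<le> \<mu> M) \<and> (\<Sum>M\<in>{M. matching n M}. \<mu> M) = 1 \<and>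
      x = (\<lambda>e. \<Sum>M\<in>{M. matching n M}. \<mu> M * chi M e)}"

definition Ein :: "nat \<Rightarrow> nat set \<Rightarrow> nat set set" where
  "Ein n S = {e \<in> E n. e \<subseteq> S}"

definition delta :: "nat \<Rightarrow> nat \<Rightarrow> nat set set" where
  "delta n v = {e \<in> E n. v \<in> e}"

datatype row = OddSet "nat set" | Deg nat | Nonneg "nat set"

definition rows :: "nat \<Rightarrow> row set" where
  "rows n = {OddSet S | S. S \<subseteq> V n \<and> odd (card S) \<and> card S \<ge> 3}
          \<union> {Deg v | v. v \<in> V n} \<union> {Nonneg e | e. e \<in> E n}"

fun rowval :: "nat \<Rightarrow> row \<Rightarrow> (nat set \<Rightarrow> real) \<Rightarrow> real" where
  "rowval n (OddSet S) g = (\<Sum>e\<in>Ein n S. g e)"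
| "rowval n (Deg v) g = (\<Sum>e\<in>delta n v. g e)"
| "rowval n (Nonneg e) g = - g e"

definition suppB :: "nat \<Rightarrow> (nat set \<Rightarrow> real) \<Rightarrow> row set" where
  "suppB n g = {r \<in> rows n. rowval n r g \<noteq> 0}"

text \<open>Circuits (there are no equality constraints, so A g = 0 is vacuous).\<close>
definition circuit :: "nat \<Rightarrow> (nat set \<Rightarrow> real) \<Rightarrow> bool" where
  "circuit n g \<longleftrightarrow> g \<in> RE n \<and> g \<noteq> (\<lambda>_. 0) \<and>
     (\<forall>y \<in> RE n. y \<noteq> (\<lambda>_. 0) \<longrightarrow> \<not> (suppB n y \<subset> suppB n g))"

definition circuit_step :: "nat \<Rightarrow> (nat set \<Rightarrow> real) \<Rightarrow> (nat set \<Rightarrow> real) \<Rightarrow> bool" where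
  "circuit_step n x x' \<longleftrightarrow> x \<in> Pmatch n \<and> x' \<in> Pmatch n \<and>
     (\<exists>c \<alpha>. circuit n c \<and> \<alpha> > 0 \<and> x' = (\<lambda>e. x e + \<alpha> * c e) \<and>
        (\<forall>\<beta>>\<alpha>. (\<lambda>e. x e + \<beta> * c e) \<notin> Pmatch n))"

definition cdist :: "nat \<Rightarrow> (nat set \<Rightarrow> real) \<Rightarrow> (nat set \<Rightarrow> real) \<Rightarrow> enat" where
  "cdist n x y = (if \<exists>l. (circuit_step n ^^ l) x y
                  then enat (LEAST l. (circuit_step n ^^ l) x y) else \<infinity>)"

definition vertex :: "nat \<Rightarrow> (nat set \<Rightarrow> real) \<Rightarrow> bool" where
  "vertex n x \<longleftrightarrow> x \<in> Pmatch n \<and>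
     \<not> (\<exists>y\<in>Pmatch n. \<exists>z\<in>Pmatch n. y \<noteq> z \<and>
          (\<exists>t::real. 0 < t \<and> t < 1 \<and> x = (\<lambda>e. t * y e + (1 - t) * z e)))"

definition circuit_diameter :: "nat \<Rightarrow> enat" where
  "circuit_diameter n = (SUP p \<in> {(x, y). vertex n x \<and> vertex n y}. cdist n (fst p) (snd p))"

end

theory Submission
  imports Defs
begin

text \<open>For \<open>n \<ge> 7\<close> any matching \<open>M\<close> and any edge \<open>e \<notin> M\<close> are one circuit step apart: an edge of \<open>M\<close>
touching \<open>e\<close> is tied to \<open>e\<close> by a degree row, and an edge \<open>f \<in> M\<close> disjoint from \<open>e\<close> by the row of an
odd set \<open>e \<union> f \<union> {w}\<close>. So two matchings are joined by a walk through a single edge outside both.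
For \<open>n \<le> 6\<close> the components of the symmetric difference are flipped one at a time, and there are
at most \<open>n div 2\<close> of them.

For the lower bounds, a circuit with no positive entry is supported on a single edge. Hence
the last step of a walk to the empty matching starts at some \<open>\<lambda> \<chi>({e})\<close>; for \<open>n = 6\<close>
no circuit leads there directly from a perfect matching, because every row that vanishes on the
difference still vanishes after deleting the matching edge disjoint from \<open>e\<close>.\<close>

section \<open>Edges, matchings and rows\<close>

lemma finite_E [simp]: "finite (E n)"
  by (rule finite_subset[of _ "Pow {0..<n}"]) (auto simp: E_def)

lemma edgeI: "i < n \<Longrightarrow> j < n \<Longrightarrow> i \<noteq> j \<Longrightarrow> {i, j} \<in> E n"
  by (auto simp: E_def)

lemma finite_delta [simp]: "finite (delta n v)"
  by (simp add: delta_def)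

lemma finite_Ein [simp]: "finite (Ein n S)"
  by (simp add: Ein_def)

lemma finite_Union_edges: "F \<subseteq> E n \<Longrightarrow> finite (\<Union>F)"
  by (rule finite_subset[of _ "{0..<n}"]) (auto simp: E_def)

lemma card_edge: "e \<in> E n \<Longrightarrow> card e = 2"
  by (auto simp: E_def)

lemma matching_subset: "matching n M \<Longrightarrow> M \<subseteq> E n"
  by (simp add: matching_def)

lemma matching_finite: "matching n M \<Longrightarrow> finite M"
  by (meson finite_E finite_subset matching_subset)

lemma finite_matchings [simp]: "finite {M. matching n M}"
  by (rule finite_subset[of _ "Pow (E n)"]) (auto simp: matching_def)

lemma matching_empty [simp]: "matching n {}"
  by (simp add: matching_def)

lemma matching_singleton: "e \<in> E n \<Longrightarrow> matching n {e}"
  by (simp add: matching_def)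

lemma matching_disjoint:
  "matching n M \<Longrightarrow> e \<in> M \<Longrightarrow> f \<in> M \<Longrightarrow> e \<inter> f \<noteq> {} \<Longrightarrow> e = f"
  by (auto simp: matching_def)

text \<open>If \<open>M\<close> leaves \<open>u\<close> uncovered, any \<open>p\<close> will do.
  Thus one vertex \<open>p\<close> per \<open>u\<close> is enough to avoid when an edge at
  \<open>u\<close> outside \<open>M\<close> is wanted.\<close>

lemma matching_partner:
  assumes "matching n M"
  obtains p where "\<And>f. f \<in> M \<Longrightarrow> u \<in> f \<Longrightarrow> f = {u, p}"
proof (cases "\<exists>f\<in>M. u \<in> f")
  case True
  then obtain f where f: "f \<in> M" "u \<in> f" by blast
  then have "f \<in> E n" using assms matching_subset by blast
  then obtain p where p: "f = {u, p}" using f(2) unfolding E_def by auto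
  have "f' = {u, p}" if "f' \<in> M" "u \<in> f'" for f'
    using matching_disjoint[OF assms f(1) that(1)] f(2) that(2) p by blast
  then show ?thesis using that by blast
qed (use that in blast)

section \<open>Rows as linear functionals and their supports\<close>

lemma rowval_diff: "rowval n r (\<lambda>e. x e - y e) = rowval n r x - rowval n r y"
  by (cases r) (auto simp: sum_subtractf)

lemma rowval_scale: "rowval n r (\<lambda>e. a * x e) = a * rowval n r x"
  by (cases r) (auto simp: sum_distrib_left)

lemma suppB_scale: "a \<noteq> 0 \<Longrightarrow> suppB n (\<lambda>e. a * x e) = suppB n x"
  by (simp add: suppB_def rowval_scale)

lemma Nonneg_in_suppB: "Nonneg e \<in> suppB n g \<longleftrightarrow> e \<in> E n \<and> g e \<noteq> 0"
  by (auto simp: suppB_def rows_def)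

lemma sum_chi: "finite F \<Longrightarrow> (\<Sum>e\<in>F. chi M e) = card {e\<in>F. e \<in> M}"
  by (simp add: chi_def sum.If_cases Int_def)

lemma chi_in_RE: "M \<subseteq> E n \<Longrightarrow> chi M \<in> RE n"
  by (auto simp: RE_def chi_def)

section \<open>The polytope and its vertices\<close>

lemma chi_in_Pmatch:
  assumes "matching n M"
  shows "chi M \<in> Pmatch n"
proof -
  let ?\<mu> = "\<lambda>N. if N = M then 1 else 0 :: real"
  have "(\<Sum>N\<in>{N. matching n N}. ?\<mu> N) = 1"
    using assms by (simp add: sum.delta)
  moreover have "chi M = (\<lambda>e. \<Sum>N\<in>{N. matching n N}. ?\<mu> N * chi N e)"
    using assms by (simp add: if_distrib[where f = "\<lambda>x. x * _"] sum.delta cong: if_cong)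
  ultimately show ?thesis
    unfolding Pmatch_def by (intro CollectI exI[of _ ?\<mu>]) simp
qed

lemma Pmatch_bounds:
  assumes "x \<in> Pmatch n"
  shows "0 \<le> x e" "x e \<le> 1"
proof -
  obtain \<mu> where \<mu>: "\<And>M. (0::real) \<le> \<mu> M" "(\<Sum>M\<in>{M. matching n M}. \<mu> M) = 1"
    "x = (\<lambda>e. \<Sum>M\<in>{M. matching n M}. \<mu> M * chi M e)"
    using assms unfolding Pmatch_def by blast
  show "0 \<le> x e"
    unfolding \<mu>(3) by (rule sum_nonneg) (simp add: \<mu>(1) chi_def)
  have "x e \<le> (\<Sum>M\<in>{M. matching n M}. \<mu> M)"
    unfolding \<mu>(3) by (rule sum_mono) (simp add: \<mu>(1) chi_def)
  then show "x e \<le> 1" using \<mu>(2) by simp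
qed

text \<open>Every 0/1 point is extreme in the unit cube: a proper convex combination of numbers in
  [0,1] equals 0 or 1 only if both numbers do.\<close>

lemma vertex_chi:
  assumes "matching n M"
  shows "vertex n (chi M)"
  unfolding vertex_def
proof (intro conjI notI)
  assume "\<exists>y\<in>Pmatch n. \<exists>z\<in>Pmatch n. y \<noteq> z \<and>
          (\<exists>t::real. 0 < t \<and> t < 1 \<and> chi M = (\<lambda>e. t * y e + (1 - t) * z e))"
  then obtain y z and t :: real where yz: "y \<in> Pmatch n" "z \<in> Pmatch n" "y \<noteq> z"
    and t: "0 < t" "t < 1" and eq: "\<And>e. chi M e = t * y e + (1 - t) * z e"
    by (metis (mono_tags, lifting))
  have "y e = z e" for e
  proof -
    note b = Pmatch_bounds[OF yz(1), of e] Pmatch_bounds[OF yz(2), of e]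
    show ?thesis
    proof (cases "e \<in> M")
      case True
      then have "t * (1 - y e) + (1 - t) * (1 - z e) = 0"
        using eq[of e] by (simp add: chi_def algebra_simps)
      moreover have "0 \<le> t * (1 - y e)" "0 \<le> (1 - t) * (1 - z e)" using t b by auto
      ultimately have "t * (1 - y e) = 0" "(1 - t) * (1 - z e) = 0" by linarith+
      then show ?thesis using t by simp
    next
      case False
      then have "t * y e + (1 - t) * z e = 0"
        using eq[of e] by (simp add: chi_def)
      moreover have "0 \<le> t * y e" "0 \<le> (1 - t) * z e" using t b by auto
      ultimately have "t * y e = 0" "(1 - t) * z e = 0" by linarith+
      then show ?thesis using t by simp
    qed
  qed
  then show False using yz(3) by blast
qed (rule chi_in_Pmatch[OF assms])

text \<open>One matching \<open>M\<close> of positive weight \<open>t\<close> is split off. If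
  \<open>t < 1\<close>, the rest, rescaled by \<open>1 - t\<close>, is a point \<open>z\<close> of
  the polytope, so \<open>x\<close> lies strictly between \<open>chi M\<close> and \<open>z\<close>,
  and extremality forces \<open>z = chi M\<close>.\<close>

lemma vertex_imp_chi:
  assumes "vertex n x"
  obtains M where "matching n M" "x = chi M"
proof -
  let ?A = "{M. matching n M}"
  have "x \<in> Pmatch n" using assms by (simp add: vertex_def)
  then obtain \<mu> where \<mu>: "\<And>M. (0::real) \<le> \<mu> M" "(\<Sum>M\<in>?A. \<mu> M) = 1"
    "x = (\<lambda>e. \<Sum>M\<in>?A. \<mu> M * chi M e)"
    unfolding Pmatch_def by blast
  obtain M where M: "matching n M" "\<mu> M \<noteq> 0"
    using \<mu>(2) by (metis (no_types, lifting) mem_Collect_eq sum.neutral zero_neq_one)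
  define t where "t = \<mu> M"
  have t0: "0 < t" using M \<mu>(1)[of M] by (simp add: t_def)
  have rest: "(\<Sum>N\<in>?A - {M}. \<mu> N) = 1 - t"
    using \<mu>(2) M by (simp add: sum_diff1 t_def)
  have split: "x e = t * chi M e + (\<Sum>N\<in>?A - {M}. \<mu> N * chi N e)" for e
    unfolding \<mu>(3) using M by (simp add: sum_diff1 t_def)
  have "t \<le> 1" using rest sum_nonneg[of "?A - {M}" \<mu>] \<mu>(1) by auto
  then consider "t = 1" | "t < 1" by linarith
  then have "x = chi M"
  proof cases
    case 1
    have "\<forall>N\<in>?A - {M}. \<mu> N = 0"
      using sum_nonneg_eq_0_iff[of "?A - {M}" \<mu>] rest 1 \<mu>(1) by auto
    then show ?thesis using split 1 by auto
  next
    case 2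
    define z where "z = (\<lambda>e. (\<Sum>N\<in>?A - {M}. \<mu> N * chi N e) / (1 - t))"
    \<comment> \<open>The weights that exhibit \<open>z\<close> as a convex combination:
      \<open>M\<close> is dropped and the others are renormalised.\<close>
    let ?\<nu> = "\<lambda>N. if N = M then 0 else \<mu> N / (1 - t)"
    have drop: "(\<Sum>N\<in>?A. ?\<nu> N * h N) = (\<Sum>N\<in>?A - {M}. \<mu> N * h N) / (1 - t)" for h
      unfolding sum_divide_distrib by (rule sum.mono_neutral_cong_right) auto
    have "(\<Sum>N\<in>?A. ?\<nu> N) = 1"
      using drop[of "\<lambda>_. 1"] rest 2 by simp
    then have "z \<in> Pmatch n"
      unfolding Pmatch_def using drop \<mu>(1) 2
      by (intro CollectI exI[of _ ?\<nu>]) (auto simp: z_def)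
    moreover have x: "x = (\<lambda>e. t * chi M e + (1 - t) * z e)"
      using split 2 by (auto simp: z_def)
    ultimately have "z = chi M"
      using assms chi_in_Pmatch[OF M(1)] t0 2 unfolding vertex_def by metis
    then show ?thesis using x by (auto simp: algebra_simps)
  qed
  then show ?thesis using M that by blast
qed

section \<open>Circuit steps between matchings\<close>

text \<open>A nonzero multiple of \<open>g\<close> has the same support as \<open>g\<close>, so its
  support cannot be strictly smaller.\<close>

lemma circuitI:
  assumes "g \<in> RE n" "g \<noteq> (\<lambda>_. 0)"
    and "\<And>y. y \<in> RE n \<Longrightarrow> suppB n y \<subseteq> suppB n g \<Longrightarrow> \<exists>t. \<forall>e. y e = t * g e"
  shows "circuit n g"
  unfolding circuit_def
proof (intro conjI ballI impI notI)
  fix y assume y: "y \<in> RE n" "y \<noteq> (\<lambda>_. 0)" "suppB n y \<subset> suppB n g"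
  then obtain t where t: "y = (\<lambda>e. t * g e)" using assms(3)[OF y(1)] by blast
  then have "t \<noteq> 0" using y(2) by auto
  then show False using y(3) suppB_scale t by auto
qed (use assms in auto)

lemma circuit_scale:
  assumes "circuit n g" "a \<noteq> 0"
  shows "circuit n (\<lambda>e. a * g e)"
  using assms by (auto simp: circuit_def suppB_scale RE_def fun_eq_iff)

text \<open>Step length 1 is maximal: a coordinate on which the two vectors differ moves between 0
  and 1 and leaves [0,1] as soon as the length exceeds 1.\<close>

lemma circuit_step_chi:
  assumes "matching n M" "matching n N" "circuit n (\<lambda>e. chi N e - chi M e)"
  shows "circuit_step n (chi M) (chi N)"
  unfolding circuit_step_def
proof (intro conjI exI[of _ "\<lambda>e. chi N e - chi M e"] exI[of _ 1] allI impI notI)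
  fix \<beta> :: real
  assume \<beta>: "1 < \<beta>" and P: "(\<lambda>e. chi M e + \<beta> * (chi N e - chi M e)) \<in> Pmatch n"
  obtain e where "chi N e \<noteq> chi M e" using assms(3) by (auto simp: circuit_def fun_eq_iff)
  then show False
    using Pmatch_bounds[OF P, of e] \<beta> by (auto simp: chi_def split: if_splits)
qed (use assms chi_in_Pmatch in auto)

text \<open>The basic tie between two edges. The row over \<open>F\<close> takes the value 1 - 1 = 0
  on the difference, hence vanishes on \<open>y\<close>; the nonnegativity rows make
  \<open>y\<close> vanish off the symmetric difference, so only \<open>y a + y b = 0\<close>
  remains.\<close>

lemma opposite_values:
  assumes r: "r \<in> rows n" "\<And>h. rowval n r h = sum h F" and F: "F \<subseteq> E n"
    and ab: "F \<inter> sym_diff M N = {a, b}" "a \<in> M - N" "b \<in> N - M"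
    and y: "y \<in> RE n" "suppB n y \<subseteq> suppB n (\<lambda>e. chi N e - chi M e)"
  shows "y b = - y a"
proof -
  let ?g = "\<lambda>e. chi N e - chi M e"
  have fin: "finite F" using F finite_subset finite_E by blast
  have ne: "a \<noteq> b" using ab by auto
  have sumF: "sum h F = h a + h b" if "\<And>e. e \<notin> sym_diff M N \<Longrightarrow> h e = 0" for h :: "nat set \<Rightarrow> real"
  proof -
    have "sum h F = sum h (F \<inter> sym_diff M N)"
      using fin that by (intro sum.mono_neutral_right) auto
    then show ?thesis using ab ne by simp
  qed
  have "sum ?g F = 0" using sumF[of ?g] ab by (auto simp: chi_def)
  then have "rowval n r y = 0" using y(2) r by (auto simp: suppB_def)
  moreover have "y e = 0" if "e \<notin> sym_diff M N" for e
  proof (rule ccontr)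
    assume "y e \<noteq> 0"
    then have "Nonneg e \<in> suppB n y" using y(1) by (auto simp: Nonneg_in_suppB RE_def)
    then have "Nonneg e \<in> suppB n ?g" using y(2) by blast
    then show False using that by (auto simp: Nonneg_in_suppB chi_def)
  qed
  ultimately show ?thesis using sumF[of y] r by simp
qed

lemma opposite_values_touching:
  assumes M: "matching n M" and N: "matching n N"
    and ab: "a \<in> M - N" "b \<in> N - M" "a \<inter> b \<noteq> {}"
    and y: "y \<in> RE n" "suppB n y \<subseteq> suppB n (\<lambda>e. chi N e - chi M e)"
  shows "y b = - y a"
proof -
  obtain u where u: "u \<in> a" "u \<in> b" using ab by blast
  have aE: "a \<in> E n" and bE: "b \<in> E n" using ab M N matching_subset by blast+
  then have "Deg u \<in> rows n" using u by (auto simp: rows_def V_def E_def)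
  \<comment> \<open>A matching has at most one edge at \<open>u\<close>, so \<open>a\<close> and
    \<open>b\<close> are the only candidates.\<close>
  moreover have "delta n u \<inter> sym_diff M N = {a, b}"
  proof (intro equalityI subsetI)
    fix f assume "f \<in> delta n u \<inter> sym_diff M N"
    then have "u \<in> f" "f \<in> M \<or> f \<in> N" by (auto simp: delta_def)
    then show "f \<in> {a, b}"
      using matching_disjoint[OF M, of f a] matching_disjoint[OF N, of f b] ab u by blast
  qed (use ab aE bE u in \<open>auto simp: delta_def\<close>)
  ultimately show ?thesis
    using opposite_values[of "Deg u" n "delta n u" M N a b y] ab y by (auto simp: delta_def)
qed

text \<open>The premise \<open>same\<close> says that \<open>y\<close> is constant up to the sign of
  the side on which an edge lies, which makes \<open>y\<close> a multiple of the difference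
  vector.\<close>

lemma circuit_chi_diffI:
  assumes "matching n M" "matching n N" "a \<in> sym_diff M N"
    and same: "\<And>y e. y \<in> RE n \<Longrightarrow> suppB n y \<subseteq> suppB n (\<lambda>e. chi N e - chi M e) \<Longrightarrow>
      e \<in> sym_diff M N \<Longrightarrow> y e = (if (e \<in> M) = (a \<in> M) then y a else - y a)"
  shows "circuit n (\<lambda>e. chi N e - chi M e)"
proof (rule circuitI)
  let ?g = "\<lambda>e. chi N e - chi M e"
  show "?g \<in> RE n" using assms(1,2) matching_subset by (auto simp: RE_def chi_def)
  have "?g a \<noteq> 0" using assms(3) by (auto simp: chi_def)
  then show "?g \<noteq> (\<lambda>_. 0)" by metis
  fix y assume y: "y \<in> RE n" "suppB n y \<subseteq> suppB n ?g"
  \<comment> \<open>Since \<open>?g a\<close> is 1 or -1, the product \<open>?g a * ?g e\<close> is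
    the sign comparing the sides of \<open>a\<close> and \<open>e\<close>.\<close>
  have "y e = (y a * ?g a) * ?g e" for e
  proof (cases "e \<in> sym_diff M N")
    case True
    then show ?thesis using same[OF y True] assms(3) by (auto simp: chi_def)
  next
    case False
    then have "Nonneg e \<notin> suppB n ?g" by (auto simp: Nonneg_in_suppB chi_def)
    then have "Nonneg e \<notin> suppB n y" using y(2) by blast
    then have "y e = 0" using y(1) by (auto simp: Nonneg_in_suppB RE_def)
    then show ?thesis using False by (auto simp: chi_def)
  qed
  then show "\<exists>t. \<forall>e. y e = t * ?g e" by blast
qed

section \<open>Flipping components\<close>

text \<open>Induction on a bound for the vertices covered by the symmetric difference: each flip of
  a component frees at least the two ends of one edge. Fewer than two covered vertices means no edge
  is left, hence the \<open>+ 2\<close>.\<close>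

lemma flip_component_walk:
  assumes "matching n M" "matching n N" "card (\<Union>(sym_diff M N)) < 2 * k + 2"
  shows "\<exists>l\<le>k. (circuit_step n ^^ l) (chi M) (chi N)"
  using assms
proof (induction k arbitrary: M)
  case 0
  have "sym_diff M N = {}"
  proof (rule ccontr)
    assume "sym_diff M N \<noteq> {}"
    then obtain e where e: "e \<in> sym_diff M N" by blast
    have sub: "sym_diff M N \<subseteq> E n" using 0 matching_subset by blast
    then have "finite (\<Union>(sym_diff M N))" by (rule finite_Union_edges)
    then have "card e \<le> card (\<Union>(sym_diff M N))" using e by (intro card_mono) auto
    then show False using 0 e sub card_edge[of e n] by auto
  qed
  then have "M = N" by blast
  then show ?case by auto
next
  case (Suc k)
  note M = Suc.prems(1) and N = Suc.prems(2)
  show ?case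
  proof (cases "M = N")
    case True
    then show ?thesis by (intro exI[of _ 0]) auto
  next
    case False
    define D where "D = sym_diff M N"
    define R where "R = {(a, b). a \<in> D \<and> b \<in> D \<and> a \<inter> b \<noteq> {}}"
    obtain e where e: "e \<in> D" using False by (auto simp: D_def)
    \<comment> \<open>The connected component of \<open>e\<close> under the touching relation
      \<open>R\<close>; flipping it turns \<open>M\<close> into \<open>L\<close>.\<close>
    define C where "C = {a. (e, a) \<in> R\<^sup>*}"
    have DE: "D \<subseteq> E n" using M N matching_subset by (auto simp: D_def)
    have CD: "C \<subseteq> D"
      using e by (auto simp: C_def R_def elim: rtranclE)
    have eC: "e \<in> C" by (simp add: C_def)
    have closed: "b \<in> C" if "a \<in> C" "b \<in> D" "a \<inter> b \<noteq> {}" for a b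
      using that CD by (auto simp: C_def R_def intro: rtrancl_into_rtrancl)
    define L where "L = sym_diff M C"
    have L: "matching n L"
      unfolding matching_def
    proof (intro conjI ballI impI)
      show "L \<subseteq> E n" using M matching_subset CD DE by (auto simp: L_def)
      \<comment> \<open>An edge kept from \<open>M\<close> cannot touch one newly taken from
        \<open>N\<close>: it would either violate the matching property of \<open>N\<close> or
        belong to the component itself.\<close>
      have mixed: "a \<inter> b = {}" if "a \<in> M - C" "b \<in> C - M" for a b
      proof (rule ccontr)
        assume ne: "a \<inter> b \<noteq> {}"
        have bN: "b \<in> N" using that CD by (auto simp: D_def)
        show False
        proof (cases "a \<in> N")
          case True
          then show False using matching_disjoint[OF N True bN ne] that by auto
        next
          case False
          then have "a \<in> D" using that by (auto simp: D_def)
          then show False using closed[of b a] that ne by blast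
        qed
      qed
      fix a b assume ab: "a \<in> L" "b \<in> L" "a \<noteq> b"
      then consider "a \<in> M" "b \<in> M" | "a \<in> N" "b \<in> N" | "a \<in> M - C" "b \<in> C - M"
        | "b \<in> M - C" "a \<in> C - M"
        using CD by (auto simp: L_def D_def)
      then show "a \<inter> b = {}"
        using matching_disjoint[OF M] matching_disjoint[OF N] ab mixed by cases blast+
    qed
    have MC: "sym_diff M L = C" by (auto simp: L_def)
    have LN: "sym_diff L N = D - C" using CD by (auto simp: L_def D_def)
    have "circuit n (\<lambda>e. chi L e - chi M e)"
    proof (rule circuit_chi_diffI[OF M L])
      show "e \<in> sym_diff M L" using MC eC by simp
      fix y f assume y: "y \<in> RE n" "suppB n y \<subseteq> suppB n (\<lambda>e. chi L e - chi M e)"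
        and f: "f \<in> sym_diff M L"
      have "(e, f) \<in> R\<^sup>*" using f MC by (auto simp: C_def)
      then show "y f = (if (f \<in> M) = (e \<in> M) then y e else - y e)"
      proof induction
        case (step a b)
        have aC: "a \<in> C" using step by (simp add: C_def)
        have bC: "b \<in> C" using step by (auto simp: C_def intro: rtrancl_into_rtrancl)
        have ab: "a \<inter> b \<noteq> {}" using step by (auto simp: R_def)
        have MC': "c \<in> M \<longleftrightarrow> c \<notin> L" if "c \<in> C" for c using that MC by auto
        \<comment> \<open>Distinct touching edges lie on opposite sides, so the value changes sign
          at each step of the path from \<open>e\<close>.\<close>
        consider "a = b" | "a \<in> M - L" "b \<in> L - M" | "b \<in> M - L" "a \<in> L - M"
          using matching_disjoint[OF M _ _ ab] matching_disjoint[OF L _ _ ab] MC'[OF aC] MC'[OF bC]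
          by blast
        then show ?case
        proof cases
          case 2
          then show ?thesis
            using step.IH opposite_values_touching[OF M L 2 ab y] by auto
        next
          case 3
          then show ?thesis
            using step.IH opposite_values_touching[OF M L 3 _ y] ab by (auto simp: Int_commute)
        qed (use step in auto)
      qed simp
    qed
    then have first: "circuit_step n (chi M) (chi L)" by (rule circuit_step_chi[OF M L])
    have fin: "finite (\<Union>D)" using DE by (rule finite_Union_edges)
    have "card (\<Union>(D - C)) + card e \<le> card (\<Union>D)"
    proof -
      have "\<Union>(D - C) \<inter> e = {}" using closed[OF eC] by blast
      then have "card (\<Union>(D - C)) + card e = card (\<Union>(D - C) \<union> e)"
        using fin e by (intro card_Un_disjoint[symmetric]) (auto intro: finite_subset)
      also have "\<dots> \<le> card (\<Union>D)" using fin e by (intro card_mono) auto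
      finally show ?thesis .
    qed
    moreover have "card e = 2" using e DE card_edge by blast
    ultimately have "card (\<Union>(sym_diff L N)) < 2 * k + 2"
      using Suc.prems(3) unfolding LN D_def[symmetric] by simp
    then obtain l where "l \<le> k" "(circuit_step n ^^ l) (chi L) (chi N)"
      using Suc.IH[OF L N] by blast
    then have "(circuit_step n ^^ Suc l) (chi M) (chi N)"
      using first by (meson relpowp_Suc_I2)
    then show ?thesis using \<open>l \<le> k\<close> by (intro exI[of _ "Suc l"]) simp
  qed
qed

section \<open>Walks through a single edge\<close>

text \<open>It suffices to tie every edge of \<open>M\<close> to \<open>e\<close>. For a disjoint
  edge \<open>f\<close> the fifth vertex \<open>w\<close> of the odd set must be chosen so that no
  third edge of \<open>M\<close> falls inside the set.\<close>

lemma circuit_single_edge: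
  assumes n: "n \<ge> 7" and M: "matching n M" and e: "e \<in> E n" "e \<notin> M"
  shows "circuit n (\<lambda>f. chi {e} f - chi M f)"
proof (rule circuit_chi_diffI[OF M matching_singleton[OF e(1)]])
  show "e \<in> sym_diff M {e}" using e by simp
  fix y f assume y: "y \<in> RE n" "suppB n y \<subseteq> suppB n (\<lambda>f. chi {e} f - chi M f)"
    and f: "f \<in> sym_diff M {e}"
  have "y e = - y f" if fM: "f \<in> M"
  proof (cases "f \<inter> e = {}")
    case False
    then show ?thesis
      using opposite_values_touching[OF M matching_singleton[OF e(1)] _ _ False y] fM e by auto
  next
    case True
    obtain u v where uv: "e = {u, v}" "u \<noteq> v" using e(1) by (auto simp: E_def)
    obtain a b where ab: "f = {a, b}" "a \<noteq> b" using fM M by (auto simp: matching_def E_def)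
    obtain p where p: "\<And>f. f \<in> M \<Longrightarrow> u \<in> f \<Longrightarrow> f = {u, p}"
      using matching_partner[OF M] by blast
    obtain q where q: "\<And>f. f \<in> M \<Longrightarrow> v \<in> f \<Longrightarrow> f = {v, q}"
      using matching_partner[OF M] by blast
    \<comment> \<open>At most six vertices are forbidden: the ends of \<open>e\<close> and
      \<open>f\<close> and the \<open>M\<close>-partners of \<open>u\<close> and \<open>v\<close>.
      This is where \<open>n \<ge> 7\<close> enters.\<close>
    have "card {u, v, p, q, a, b} < card {0..<n}"
      using n card_length[of "[u, v, p, q, a, b]"] by simp
    then have "\<not> {0..<n} \<subseteq> {u, v, p, q, a, b}"
      by (meson card_mono finite.emptyI finite.insertI not_le)
    then obtain w where w: "w < n" "w \<notin> {u, v, p, q, a, b}"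
      by (meson atLeastLessThan_iff subsetI)
    define S where "S = {u, v, a, b, w}"
    have fE: "f \<in> E n" using fM M matching_subset by blast
    have "S \<subseteq> V n" using e(1) fE w uv ab by (auto simp: S_def V_def E_def)
    moreover have "card S = 5" using True uv ab w by (auto simp: S_def)
    ultimately have r: "OddSet S \<in> rows n" by (auto simp: rows_def)
    \<comment> \<open>A third edge of \<open>M\<close> inside \<open>S\<close> would lie in
      \<open>{u, v, w}\<close>; but \<open>w\<close> is no partner of \<open>u\<close> or
      \<open>v\<close>, and \<open>{u, v}\<close> is \<open>e\<close>.\<close>
    have "Ein n S \<inter> sym_diff M {e} = {f, e}"
    proof (intro equalityI subsetI)
      fix f' assume f': "f' \<in> Ein n S \<inter> sym_diff M {e}"
      show "f' \<in> {f, e}"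
      proof (rule ccontr)
        assume no: "f' \<notin> {f, e}"
        then have f'M: "f' \<in> M" and f'S: "f' \<subseteq> S" and f'E: "f' \<in> E n"
          using f' by (auto simp: Ein_def)
        have "f' \<inter> f = {}" using matching_disjoint[OF M f'M fM] no by blast
        then have sub: "f' \<subseteq> {u, v, w}" using f'S ab by (auto simp: S_def)
        have "u \<notin> f'"
        proof
          assume "u \<in> f'"
          then have "f' = {u, p}" using p f'M by blast
          then show False using sub w no uv f'E by (auto simp: E_def doubleton_eq_iff)
        qed
        moreover have "v \<notin> f'"
        proof
          assume "v \<in> f'"
          then have "f' = {v, q}" using q f'M by blast
          then show False using sub w no uv f'E by (auto simp: E_def doubleton_eq_iff)
        qed
        ultimately have "f' \<subseteq> {w}" using sub by blast
        then show False using f'E by (auto simp: E_def)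
      qed
    qed (use fM e fE uv ab in \<open>auto simp: Ein_def S_def\<close>)
    then show ?thesis
      using opposite_values[OF r _ _ _ _ _ y, of "Ein n S" f e] fM e by (auto simp: Ein_def)
  qed
  then show "y f = (if (f \<in> M) = (e \<in> M) then y e else - y e)"
    using f e by auto
qed

text \<open>The intermediate vertex is \<open>chi {e}\<close> with \<open>e = {0, w}\<close>, where
  \<open>w\<close> avoids the partners of 0 in both matchings. Length exactly 2 works even for
  \<open>M = N\<close>, by going out and back.\<close>

lemma two_step_walk:
  assumes n: "n \<ge> 7" and M: "matching n M" and N: "matching n N"
  shows "(circuit_step n ^^ 2) (chi M) (chi N)"
proof -
  obtain p where p: "\<And>f. f \<in> M \<Longrightarrow> 0 \<in> f \<Longrightarrow> f = {0, p}"
    using matching_partner[OF M] by blast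
  obtain q where q: "\<And>f. f \<in> N \<Longrightarrow> 0 \<in> f \<Longrightarrow> f = {0, q}"
    using matching_partner[OF N] by blast
  have "card {0, p, q} < card {0..<n}"
    using n card_length[of "[0, p, q]"] by simp
  then have "\<not> {0..<n} \<subseteq> {0, p, q}"
    by (meson card_mono finite.emptyI finite.insertI not_le)
  then obtain w where w: "w < n" "w \<notin> {0, p, q}"
    by (meson atLeastLessThan_iff subsetI)
  define e where "e = {0, w}"
  have e: "e \<in> E n" unfolding e_def using w n by (intro edgeI) auto
  have eM: "e \<notin> M" using p[of e] w by (auto simp: e_def doubleton_eq_iff)
  have eN: "e \<notin> N" using q[of e] w by (auto simp: e_def doubleton_eq_iff)
  have "circuit_step n (chi M) (chi {e})"
    by (rule circuit_step_chi[OF M matching_singleton[OF e] circuit_single_edge[OF n M e eM]])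
  \<comment> \<open>The second step traverses a single-edge circuit backwards.\<close>
  moreover have "circuit n (\<lambda>f. chi N f - chi {e} f)"
    using circuit_scale[OF circuit_single_edge[OF n N e eN], of "-1"] by simp
  then have "circuit_step n (chi {e}) (chi N)"
    by (rule circuit_step_chi[OF matching_singleton[OF e] N])
  ultimately show ?thesis by (auto simp: numeral_2_eq_2)
qed

section \<open>Lower bounds\<close>

text \<open>Without positive entries nothing cancels, so each row that sees \<open>e\<close> is
  nonzero on \<open>c\<close>. A second support edge \<open>f\<close> would make the support of
  \<open>chi {e}\<close> strictly smaller.\<close>

lemma circuit_nonpos_support:
  assumes c: "circuit n c" and nonpos: "\<And>e. c e \<le> 0" and ef: "c e \<noteq> 0" "c f \<noteq> 0"
  shows "e = f"
proof (rule ccontr)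
  assume ne: "e \<noteq> f"
  have E: "e \<in> E n" "f \<in> E n" using c ef by (auto simp: circuit_def RE_def)
  have neg: "sum c F < 0" if "finite F" "e \<in> F" for F
    using sum_pos2[OF that, of "\<lambda>f. - c f"] nonpos ef(1) by (simp add: sum_negf order_less_le)
  have "rowval n r c \<noteq> 0" if "rowval n r (chi {e}) \<noteq> 0" for r
  proof (cases r)
    case (Nonneg x)
    then show ?thesis using that ef by (auto simp: chi_def split: if_splits)
  next
    case (Deg v)
    then have "e \<in> delta n v" using that by (auto simp: chi_def split: if_splits)
    then have "sum c (delta n v) < 0" by (intro neg) simp_all
    then show ?thesis using Deg by simp
  next
    case (OddSet S)
    then have "e \<in> Ein n S" using that by (auto simp: chi_def split: if_splits)
    then have "sum c (Ein n S) < 0" by (intro neg) simp_all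
    then show ?thesis using OddSet by simp
  qed
  then have "suppB n (chi {e}) \<subseteq> suppB n c" by (auto simp: suppB_def)
  moreover have "Nonneg f \<in> suppB n c" "Nonneg f \<notin> suppB n (chi {e})"
    using E ef ne by (auto simp: Nonneg_in_suppB chi_def)
  ultimately have "suppB n (chi {e}) \<subset> suppB n c" by blast
  moreover have "chi {e} \<noteq> (\<lambda>_. 0)" by (auto simp: chi_def fun_eq_iff)
  ultimately show False using c E chi_in_RE[of "{e}" n] by (auto simp: circuit_def)
qed

text \<open>A step into the origin has direction \<open>-x\<close> up to a positive factor, hence no
  positive entries.\<close>

lemma circuit_step_to_empty:
  assumes "circuit_step n x (chi {})"
  obtains e where "e \<in> E n" "0 < x e" "\<And>f. f \<noteq> e \<Longrightarrow> x f = 0"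
proof -
  obtain c \<alpha> where c: "circuit n c" and \<alpha>: "\<alpha> > 0"
    and eq: "chi {} = (\<lambda>e. x e + \<alpha> * c e)" and x: "x \<in> Pmatch n"
    using assms by (auto simp: circuit_step_def)
  have xe: "x e = - (\<alpha> * c e)" for e using fun_cong[OF eq, of e] by (simp add: chi_def)
  have nonpos: "c e \<le> 0" for e
    using Pmatch_bounds(1)[OF x, of e] \<alpha> by (simp add: xe mult_le_0_iff)
  obtain e where e: "c e \<noteq> 0" using c by (auto simp: circuit_def fun_eq_iff)
  show ?thesis
  proof
    show "e \<in> E n" using e c by (auto simp: circuit_def RE_def)
    show "0 < x e" using e nonpos[of e] \<alpha> by (simp add: xe mult_less_0_iff)
    show "x f = 0" if "f \<noteq> e" for f
      using circuit_nonpos_support[OF c nonpos e, of f] that by (auto simp: xe)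
  qed
qed

lemma no_circuit_perfect6:
  fixes t :: real
  assumes M: "M = {{0, 1}, {2, 3}, {4, 5}}" and e: "e \<in> E 6" "e \<notin> M" and t: "0 < t" "t \<le> 1"
  shows "\<not> circuit 6 (\<lambda>f. t * chi {e} f - chi M f)"
proof
  let ?h = "\<lambda>f. t * chi {e} f - chi M f"
  assume h: "circuit 6 ?h"
  obtain i j where ij: "e = {i, j}" "i < 6" "j < 6" "i \<noteq> j" using e by (auto simp: E_def)
  have "i = 0 \<or> i = 1 \<or> i = 2 \<or> i = 3 \<or> i = 4 \<or> i = 5"
    "j = 0 \<or> j = 1 \<or> j = 2 \<or> j = 3 \<or> j = 4 \<or> j = 5" using ij by auto
  \<comment> \<open>The two ends of \<open>e\<close> meet at most two of the three matching
    edges.\<close>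
  then have "\<exists>g\<in>M. g \<inter> e = {}"
    unfolding M ij(1) by (elim disjE; simp)
  then obtain g where g: "g \<in> M" "g \<inter> e = {}" by blast
  have mat: "matching 6 M" by (auto simp: M matching_def intro!: edgeI)
  have cM: "card M = 3" by (simp add: M doubleton_eq_iff)
  have gE: "g \<in> E 6" and ME: "M \<subseteq> E 6" using mat g matching_subset by blast+
  have finM: "finite M" using mat matching_finite by blast
  let ?y = "\<lambda>f. t * chi {e} f - chi (M - {g}) f"
  have y: "?y f = ?h f - (- 1) * chi {g} f" for f using g by (auto simp: chi_def)
  have row_y: "rowval 6 r ?y = rowval 6 r ?h + rowval 6 r (chi {g})" for r
    unfolding y rowval_diff rowval_scale by simp
  have row_h: "rowval 6 r ?h = t * rowval 6 r (chi {e}) - rowval 6 r (chi M)" for r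
    unfolding rowval_diff rowval_scale by simp
  have "rowval 6 r ?h \<noteq> 0" if r: "r \<in> rows 6" and nz: "rowval 6 r ?y \<noteq> 0" for r
  proof (cases "rowval 6 r (chi {g}) = 0")
    case True
    then show ?thesis using nz row_y by simp
  next
    case False
    show ?thesis
    proof (cases r)
      case (Nonneg f)
      then have "f = g" using False by (auto simp: chi_def split: if_splits)
      then show ?thesis using g(1) e(2) Nonneg by (auto simp: chi_def)
    next
      case (Deg v)
      then have "v \<in> g" using False by (auto simp: sum_chi delta_def)
      then have "{f \<in> delta 6 v. f \<in> {e}} = {}" and "g \<in> {f \<in> delta 6 v. f \<in> M}"
        using g gE by (auto simp: delta_def)
      then have "card {f \<in> delta 6 v. f \<in> {e}} = 0" and "card {f \<in> delta 6 v. f \<in> M} \<noteq> 0"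
        using card_0_eq[of "{f \<in> delta 6 v. f \<in> M}"] by auto
      then show ?thesis
        unfolding row_h unfolding Deg rowval.simps sum_chi[OF finite_delta]
        by (simp only: of_nat_0 mult_zero_right diff_0 neg_equal_0_iff_equal of_nat_eq_0_iff
            not_False_eq_True)
    next
      case (OddSet S)
      then have gS: "g \<subseteq> S" using False by (auto simp: sum_chi Ein_def)
      have S: "S \<subseteq> V 6" "odd (card S)" "card S \<ge> 3" using r OddSet by (auto simp: rows_def)
      have finS: "finite S" using S(1) finite_subset by (auto simp: V_def)
      have "card S \<le> 6" using card_mono[OF _ S(1)] by (simp add: V_def)
      then have "card S = 3 \<or> card S = 5" using S
        by (cases "card S = 4"; cases "card S = 6") auto
      then show ?thesis
      proof
        assume 3: "card S = 3"
        \<comment> \<open>The disjoint edges \<open>g\<close> and \<open>e\<close> span four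
          vertices, too many for \<open>S\<close>.\<close>
        have "\<not> e \<subseteq> S"
        proof
          assume "e \<subseteq> S"
          then have "card (g \<union> e) \<le> card S" using gS finS by (intro card_mono) auto
          moreover have "card (g \<union> e) = card g + card e"
            using g gS \<open>e \<subseteq> S\<close> finS by (intro card_Un_disjoint) (auto intro: finite_subset)
          ultimately show False using 3 card_edge[OF gE] card_edge[OF e(1)] by simp
        qed
        then have "{f \<in> Ein 6 S. f \<in> {e}} = {}" and "g \<in> {f \<in> Ein 6 S. f \<in> M}"
          using g gE gS by (auto simp: Ein_def)
        then have "card {f \<in> Ein 6 S. f \<in> {e}} = 0" and "card {f \<in> Ein 6 S. f \<in> M} \<noteq> 0"
          using card_0_eq[of "{f \<in> Ein 6 S. f \<in> M}"] by auto
        then show ?thesis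
          unfolding row_h unfolding OddSet rowval.simps sum_chi[OF finite_Ein]
          by (simp only: of_nat_0 mult_zero_right diff_0 neg_equal_0_iff_equal of_nat_eq_0_iff
              not_False_eq_True)
      next
        assume 5: "card S = 5"
        have "card (V 6 - S) = 1" using 5 S(1) finS by (simp add: card_Diff_subset V_def)
        then obtain v where v: "V 6 - S = {v}" by (auto simp: card_1_singleton_iff)
        obtain p where p: "\<And>f. f \<in> M \<Longrightarrow> v \<in> f \<Longrightarrow> f = {v, p}"
          using matching_partner[OF mat] by blast
        \<comment> \<open>A 5-set misses a single vertex \<open>v\<close>, so it contains at least
          two edges of \<open>M\<close>, which outweigh the contribution of \<open>e\<close>, at
          most \<open>t \<le> 1\<close>.\<close>
        have "M - {{v, p}} \<subseteq> {f \<in> Ein 6 S. f \<in> M}"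
        proof
          fix f assume f: "f \<in> M - {{v, p}}"
          then have "f \<in> E 6" "v \<notin> f" using p ME by auto
          moreover have "f \<subseteq> V 6" using \<open>f \<in> E 6\<close> by (auto simp: E_def V_def)
          ultimately show "f \<in> {f \<in> Ein 6 S. f \<in> M}" using f v by (auto simp: Ein_def)
        qed
        then have "card (M - {{v, p}}) \<le> card {f \<in> Ein 6 S. f \<in> M}"
          by (rule card_mono[rotated]) simp
        moreover have "card (M - {{v, p}}) \<ge> 2"
          using cM finM by (simp add: card_Diff_singleton_if)
        ultimately have big: "real (card {f \<in> Ein 6 S. f \<in> M}) \<ge> 2" by simp
        have "card {f \<in> Ein 6 S. f \<in> {e}} \<le> card {e}" by (rule card_mono) auto
        then have "t * real (card {f \<in> Ein 6 S. f \<in> {e}}) \<le> 1"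
          using t by (simp add: mult_le_one)
        then show ?thesis
          using big unfolding row_h unfolding OddSet rowval.simps sum_chi[OF finite_Ein] by auto
      qed
    qed
  qed
  then have "suppB 6 ?y \<subseteq> suppB 6 ?h" by (auto simp: suppB_def)
  moreover have "Nonneg g \<in> suppB 6 ?h" "Nonneg g \<notin> suppB 6 ?y"
    using g gE e by (auto simp: Nonneg_in_suppB chi_def)
  ultimately have "suppB 6 ?y \<subset> suppB 6 ?h" by blast
  moreover have "?y \<in> RE 6" using ME e by (auto simp: RE_def chi_def)
  moreover have "?y e \<noteq> 0" using e t by (simp add: chi_def)
  then have "?y \<noteq> (\<lambda>_. 0)" by metis
  ultimately show False using h by (auto simp: circuit_def)
qed

text \<open>The middle point of such a walk must be \<open>t\<close> times some
  \<open>chi {e}\<close>, so its difference from \<open>chi M\<close> would be a circuit.\<close>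

lemma no_two_step_walk6:
  assumes M: "M = {{0, 1}, {2, 3}, {4, 5}}"
  shows "\<not> (circuit_step 6 ^^ 2) (chi M) (chi {})"
proof
  assume "(circuit_step 6 ^^ 2) (chi M) (chi {})"
  then obtain z where z1: "circuit_step 6 (chi M) z" and z2: "circuit_step 6 z (chi {})"
    by (auto simp: numeral_2_eq_2)
  obtain e where e: "e \<in> E 6" "0 < z e" "\<And>f. f \<noteq> e \<Longrightarrow> z f = 0"
    using circuit_step_to_empty[OF z2] by blast
  define t where "t = z e"
  have zP: "z \<in> Pmatch 6" using z1 by (simp add: circuit_step_def)
  have t: "0 < t" "t \<le> 1" using e(2) Pmatch_bounds(2)[OF zP] by (auto simp: t_def)
  have z: "z f = t * chi {e} f" for f using e(3)[of f] by (cases "f = e") (auto simp: t_def chi_def)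
  obtain c \<alpha> where c: "circuit 6 c" "\<alpha> > 0" and eq: "z = (\<lambda>f. chi M f + \<alpha> * c f)"
    using z1 by (auto simp: circuit_step_def)
  have "\<alpha> * c f = t * chi {e} f - chi M f" for f using fun_cong[OF eq, of f] z by simp
  then have h: "circuit 6 (\<lambda>f. t * chi {e} f - chi M f)"
    using circuit_scale[OF c(1), of \<alpha>] c(2) by simp
  show False
  proof (cases "e \<in> M")
    case False
    then show ?thesis using no_circuit_perfect6[OF M e(1) False t] h by blast
  next
    case True
    \<comment> \<open>For \<open>e\<close> in \<open>M\<close> the difference has no positive entry,
      yet it is nonzero on the two other edges of \<open>M\<close>.\<close>
    have "\<exists>a\<in>M. \<exists>b\<in>M. a \<noteq> e \<and> b \<noteq> e \<and> a \<noteq> b"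
      using True unfolding M by (elim insertE emptyE; simp add: doubleton_eq_iff)
    then obtain a b where "a \<in> M" "b \<in> M" "a \<noteq> e" "b \<noteq> e" "a \<noteq> b" by blast
    moreover have "t * chi {e} f - chi M f \<le> 0" for f using t True by (auto simp: chi_def)
    ultimately show ?thesis
      using circuit_nonpos_support[OF h, of a b] by (auto simp: chi_def)
  qed
qed

section \<open>The diameter\<close>

lemma cdist_le:
  assumes "(circuit_step n ^^ l) x y" "l \<le> k"
  shows "cdist n x y \<le> enat k"
proof -
  have "(LEAST l. (circuit_step n ^^ l) x y) \<le> l" using assms(1) by (rule Least_le)
  then show ?thesis using assms by (auto simp: cdist_def)
qed

text \<open>If no walk exists at all, the distance is infinite and the bound is trivial.\<close>

lemma cdist_ge:
  assumes "\<And>l. l < k \<Longrightarrow> \<not> (circuit_step n ^^ l) x y"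
  shows "enat k \<le> cdist n x y"
proof (cases "\<exists>l. (circuit_step n ^^ l) x y")
  case True
  then have "(circuit_step n ^^ (LEAST l. (circuit_step n ^^ l) x y)) x y" by (rule LeastI_ex)
  then show ?thesis using assms True by (auto simp: cdist_def not_less[symmetric])
qed (simp add: cdist_def)

lemma circuit_diameter_le:
  assumes "\<And>M N. matching n M \<Longrightarrow> matching n N \<Longrightarrow>
    \<exists>l\<le>k. (circuit_step n ^^ l) (chi M) (chi N)"
  shows "circuit_diameter n \<le> enat k"
  unfolding circuit_diameter_def
proof (rule SUP_least)
  fix p assume "p \<in> {(x, y). vertex n x \<and> vertex n y}"
  then obtain M N where "matching n M" "matching n N" "fst p = chi M" "snd p = chi N"
    by (metis (mono_tags, lifting) case_prod_unfold mem_Collect_eq vertex_imp_chi)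
  then show "cdist n (fst p) (snd p) \<le> enat k" using assms cdist_le by metis
qed

lemma circuit_diameter_ge:
  assumes "matching n M" "matching n N"
    and "\<And>l. l < k \<Longrightarrow> \<not> (circuit_step n ^^ l) (chi M) (chi N)"
  shows "enat k \<le> circuit_diameter n"
  unfolding circuit_diameter_def
  using assms vertex_chi cdist_ge
  by (intro SUP_upper2[of "(chi M, chi N)"]) auto

lemma chi_ne_empty: "M \<noteq> {} \<Longrightarrow> chi M \<noteq> chi {}"
  by (auto simp: chi_def fun_eq_iff)

text \<open>A point one step from the origin has a single nonzero coordinate, while
  \<open>chi M\<close> has at least two.\<close>

lemma no_step_to_empty:
  assumes "a \<in> M" "b \<in> M" "a \<noteq> b"
  shows "\<not> circuit_step n (chi M) (chi {})"
proof
  assume "circuit_step n (chi M) (chi {})"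
  then obtain e where "\<And>f. f \<noteq> e \<Longrightarrow> chi M f = 0" by (rule circuit_step_to_empty) blast
  then show False using assms by (metis chi_def zero_neq_one)
qed

lemma circuit_diameter_ge_1:
  assumes "n \<ge> 2"
  shows "1 \<le> circuit_diameter n"
proof -
  have "{0, 1} \<in> E n" using assms by (intro edgeI) auto
  then have "enat 1 \<le> circuit_diameter n"
    using chi_ne_empty[of "{{0, 1}}"]
    by (intro circuit_diameter_ge[OF matching_singleton matching_empty]) auto
  then show ?thesis by (simp add: one_enat_def)
qed

lemma circuit_diameter_ge_2:
  assumes "n \<ge> 4"
  shows "2 \<le> circuit_diameter n"
proof -
  let ?M = "{{0, 1}, {2, 3}} :: nat set set"
  have "{0, 1} \<in> E n" "{2, 3} \<in> E n" using assms by (auto intro!: edgeI)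
  then have M: "matching n ?M" by (auto simp: matching_def)
  have "enat 2 \<le> circuit_diameter n"
  proof (rule circuit_diameter_ge[OF M matching_empty])
    fix l :: nat assume "l < 2"
    then have "l = 0 \<or> l = 1" by auto
    then show "\<not> (circuit_step n ^^ l) (chi ?M) (chi {})"
      using chi_ne_empty[of ?M] no_step_to_empty[of "{0, 1}" ?M "{2, 3}" n]
      by (auto simp: doubleton_eq_iff)
  qed
  then show ?thesis by (simp add: numeral_eq_enat)
qed

lemma circuit_diameter_6_ge_3: "3 \<le> circuit_diameter 6"
proof -
  let ?M = "{{0, 1}, {2, 3}, {4, 5}} :: nat set set"
  have M: "matching 6 ?M" by (auto simp: matching_def intro!: edgeI)
  have "enat 3 \<le> circuit_diameter 6"
  proof (rule circuit_diameter_ge[OF M matching_empty])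
    fix l :: nat assume "l < 3"
    then have "l = 0 \<or> l = 1 \<or> l = 2" by auto
    then show "\<not> (circuit_step 6 ^^ l) (chi ?M) (chi {})"
      using chi_ne_empty[of ?M] no_step_to_empty[of "{0, 1}" ?M "{2, 3}" 6]
        no_two_step_walk6[of ?M]
      by (auto simp: doubleton_eq_iff)
  qed
  then show ?thesis by (simp add: numeral_eq_enat)
qed

text \<open>The symmetric difference covers at most \<open>n\<close> vertices, and
  \<open>n < 2 * (n div 2) + 2\<close>.\<close>

lemma circuit_diameter_le_half: "circuit_diameter n \<le> enat (n div 2)"
proof (rule circuit_diameter_le)
  fix M N assume MN: "matching n M" "matching n N"
  then have "\<Union>(sym_diff M N) \<subseteq> {0..<n}" by (auto simp: matching_def E_def)
  then have "card (\<Union>(sym_diff M N)) \<le> n" using card_mono[of "{0..<n}"] by simp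
  then show "\<exists>l\<le>n div 2. (circuit_step n ^^ l) (chi M) (chi N)"
    by (intro flip_component_walk[OF MN]) linarith
qed

lemma circuit_diameter_le_2: "n \<ge> 7 \<Longrightarrow> circuit_diameter n \<le> enat 2"
  by (rule circuit_diameter_le) (use two_step_walk in blast)

theorem theorem1:
  fixes n :: nat
  assumes "n \<ge> 2"
  shows "circuit_diameter n =
    (if n \<le> 3 then 1 else if n \<le> 5 then 2 else if n = 6 then 3 else 2)"
proof -
  \<comment> \<open>In the first three cases \<open>n div 2\<close> is 1, 2 and 3, which matches the
    lower bounds.\<close>
  consider "n = 2 \<or> n = 3" | "n = 4 \<or> n = 5" | "n = 6" | "n \<ge> 7" using assms by linarith
  then show ?thesis
  proof cases
    case 1
    then show ?thesis
      using circuit_diameter_ge_1[of n] circuit_diameter_le_half[of n]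
      by (auto simp: one_enat_def intro!: antisym)
  next
    case 2
    then show ?thesis
      using circuit_diameter_ge_2[of n] circuit_diameter_le_half[of n]
      by (auto simp: numeral_eq_enat intro!: antisym)
  next
    case 3
    then show ?thesis
      using circuit_diameter_6_ge_3 circuit_diameter_le_half[of n]
      by (auto simp: numeral_eq_enat intro!: antisym)
  next
    case 4
    then show ?thesis
      using circuit_diameter_ge_2[of n] circuit_diameter_le_2[of n]
      by (auto simp: numeral_eq_enat intro!: antisym)
  qed
qed

end
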